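(* Let $M$ be a matroid of rank $2$ (on a finite ground set). Then the $h$-vector $h(M)$ is a pure $O$-sequence.
   Context: A matroid $M=(E(M),\mathcal{I}(M))$ has a finite ground set $E(M)$ and family of independent sets $\mathcal{I}(M)\subseteq 2^{E(M)}$; its rank is the cardinality of a maximal independent set (a basis). If $M$ has rank $d$, its $f$-vector is $(f_{-1}(M),f_0(M),\ldots,f_{d-1}(M))$ with $f_{i-1}(M)=|\{A\in\mathcal{I}(M): |A|=i\}|$. Its $h$-vector $h(M)=(h_0(M),\ldots,h_d(M))$ is defined by the polynomial identity in $\lambda$ $$\sum_{j=0}^d h_j(M)\lambda^j=\sum_{i=0}^d f_{i-1}(M)\lambda^i(1-\lambda)^{d-i}.$$ An order ideal $\mathcal{O}$ is a nonempty family of monomials (in finitely many variables) of degree at most some $r$, such that if $\mu\in\mathcal{O}$ and $\nu\mid\mu$ then $\nu\in\mathcal{O}$. Put $F_i(\mathcal{O})=$ the number of monomials of degree $i$ in $\mathcal{O}$ and $F(\mathcal{O})=(F_0(\mathcal{O}),\ldots,F_r(\mathcal{O}))$; trailing entries are allowed to be zero. $\mathcal{O}$ is pure if all of its maximal monomials under divisibility have the same degree. A vector $\mathbf{h}=(h_0,\ldots,h_d)$ is a pure $O$-sequence if there is a pure order ideal $\mathcal{O}$ of monomials of degree at most $d$ with $\mathbf{h}=F(\mathcal{O})=(F_0(\mathcal{O}),\ldots,F_d(\mathcal{O}))$. *)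

theory Defs
  imports "HOL-Library.Multiset" "HOL-Computational_Algebra.Polynomial"
begin

locale matroid =
  fixes E :: "'a set" and \<I> :: "'a set set"
  assumes finite_ground: "finite E"
    and indep_subset_ground: "A \<in> \<I> \<Longrightarrow> A \<subseteq> E"
    and indep_empty: "{} \<in> \<I>"
    and indep_subset: "A \<in> \<I> \<Longrightarrow> B \<subseteq> A \<Longrightarrow> B \<in> \<I>"
    and augmentation:
      "A \<in> \<I> \<Longrightarrow> B \<in> \<I> \<Longrightarrow> card A < card B \<Longrightarrow> \<exists>x \<in> B - A. insert x A \<in> \<I>"

definition basis :: "'a set set \<Rightarrow> 'a set \<Rightarrow> bool" where
  "basis \<I> B \<longleftrightarrow> B \<in> \<I> \<and> (\<forall>A \<in> \<I>. B \<subseteq> A \<longrightarrow> A = B)"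

definition matroid_rank :: "'a set set \<Rightarrow> nat" where
  "matroid_rank \<I> = (THE r. \<exists>B. basis \<I> B \<and> card B = r)"

text \<open>The index is the cardinality of the sets counted (dimension plus one): \<open>f_number \<I> i\<close> is
  the entry written $f_{i-1}$ of the $f$-vector.\<close>

definition f_number :: "'a set set \<Rightarrow> nat \<Rightarrow> nat" where
  "f_number \<I> i = card {A \<in> \<I>. card A = i}"

text \<open>With \<open>[:0, 1:]\<close> as the indeterminate $\lambda$, this is
  $\sum_{i=0}^d f_{i-1} \lambda^i (1-\lambda)^{d-i}$.\<close>

definition h_polynomial :: "'a set set \<Rightarrow> int poly" where
  "h_polynomial \<I> =
     (\<Sum>i\<le>matroid_rank \<I>.
        smult (int (f_number \<I> i)) ([:0, 1:] ^ i * [:1, -1:] ^ (matroid_rank \<I> - i)))"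

definition h_vector :: "'a set set \<Rightarrow> int list" where
  "h_vector \<I> = map (coeff (h_polynomial \<I>)) [0..<Suc (matroid_rank \<I>)]"

text \<open>A monomial is the multiset of its variables counted with exponents, so that the degree is
  \<open>size\<close> and divisibility is \<open>\<subseteq>#\<close>.\<close>

definition order_ideal :: "nat \<Rightarrow> 'v multiset set \<Rightarrow> bool" where
  "order_ideal r \<O> \<longleftrightarrow>
     \<O> \<noteq> {} \<and>
     (\<exists>V. finite V \<and> (\<forall>\<mu> \<in> \<O>. set_mset \<mu> \<subseteq> V)) \<and>
     (\<forall>\<mu> \<in> \<O>. size \<mu> \<le> r) \<and>
     (\<forall>\<mu> \<in> \<O>. \<forall>\<nu>. \<nu> \<subseteq># \<mu> \<longrightarrow> \<nu> \<in> \<O>)"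

definition maximal_monomial :: "'v multiset set \<Rightarrow> 'v multiset \<Rightarrow> bool" where
  "maximal_monomial \<O> \<mu> \<longleftrightarrow> \<mu> \<in> \<O> \<and> (\<forall>\<nu> \<in> \<O>. \<mu> \<subseteq># \<nu> \<longrightarrow> \<nu> = \<mu>)"

definition pure :: "'v multiset set \<Rightarrow> bool" where
  "pure \<O> \<longleftrightarrow>
     (\<forall>\<mu> \<nu>. maximal_monomial \<O> \<mu> \<longrightarrow> maximal_monomial \<O> \<nu> \<longrightarrow> size \<mu> = size \<nu>)"

definition F_vector :: "nat \<Rightarrow> 'v multiset set \<Rightarrow> nat list" where
  "F_vector r \<O> = map (\<lambda>i. card {\<mu> \<in> \<O>. size \<mu> = i}) [0..<Suc r]"

text \<open>Entries are integers because those of an $h$-vector are so a priori. The variables are drawn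
  from a countable supply indexed by \<open>nat\<close>; each order ideal uses finitely many of them. Comparing
  lengths forces \<open>d\<close> to be \<open>length hs - 1\<close>.\<close>

definition pure_O_sequence :: "int list \<Rightarrow> bool" where
  "pure_O_sequence hs \<longleftrightarrow>
     (\<exists>d (\<O> :: nat multiset set).
        order_ideal d \<O> \<and> pure \<O> \<and> hs = map int (F_vector d \<O>))"

text \<open>All bases have the same cardinality, so the definite description in \<open>matroid_rank\<close> is
  justified.\<close>

lemma (in matroid) card_basis:
  assumes "basis \<I> B"
  shows "card B = matroid_rank \<I>"
proof -
  have le: "card C \<le> card D" if "basis \<I> C" "basis \<I> D" for C D
  proof (rule ccontr)
    assume "\<not> card C \<le> card D"
    then obtain x where "x \<in> C - D" "insert x D \<in> \<I>"
      using augmentation[of D C] \<open>basis \<I> C\<close> \<open>basis \<I> D\<close> by (auto simp: basis_def)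
    with \<open>basis \<I> D\<close> show False by (auto simp: basis_def)
  qed
  have "(THE r. \<exists>C. basis \<I> C \<and> card C = r) = card B"
    by (rule the_equality) (use assms le in \<open>auto intro: le_antisym\<close>)
  then show ?thesis by (simp add: matroid_rank_def)
qed

lemma (in matroid) basis_exists: "\<exists>B. basis \<I> B"
proof -
  have "finite \<I>"
    by (rule finite_subset[of _ "Pow E"]) (use finite_ground indep_subset_ground in auto)
  then obtain B where "B \<in> \<I>" "\<forall>A\<in>\<I>. B \<subseteq> A \<longrightarrow> B = A"
    using finite_has_maximal[of \<I>] indep_empty by blast
  then show ?thesis by (auto simp: basis_def)
qed

text \<open>The entries of \<open>h_vector\<close> satisfy the defining polynomial identity
  $\sum_{j=0}^d h_j \lambda^j = \sum_{i=0}^d f_{i-1} \lambda^i (1-\lambda)^{d-i}$.\<close>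

lemma h_vector_identity:
  "(\<Sum>j\<le>matroid_rank \<I>. monom (h_vector \<I> ! j) j) = h_polynomial \<I>"
proof -
  let ?d = "matroid_rank \<I>"
  have "degree (h_polynomial \<I>) \<le> ?d"
    unfolding h_polynomial_def
  proof (rule degree_sum_le)
    fix i assume "i \<in> {..?d}"
    have "degree ([:0, 1:] ^ i * [:1, -1:] ^ (?d - i) :: int poly)
        \<le> degree ([:0, 1:] ^ i :: int poly) + degree ([:1, -1:] ^ (?d - i) :: int poly)"
      by (rule degree_mult_le)
    also have "\<dots> \<le> i + (?d - i)"
      using degree_power_le[of "[:0, 1:] :: int poly" i]
        degree_power_le[of "[:1, -1:] :: int poly" "?d - i"]
      by (intro add_mono) simp_all
    finally show "degree (smult (int (f_number \<I> i)) ([:0, 1:] ^ i * [:1, -1:] ^ (?d - i))) \<le> ?d"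
      using \<open>i \<in> {..?d}\<close> degree_smult_le le_trans by fastforce
  qed simp
  then have "(\<Sum>j\<le>?d. monom (coeff (h_polynomial \<I>) j) j) = h_polynomial \<I>"
    by (rule poly_as_sum_of_monoms')
  moreover have "h_vector \<I> ! j = coeff (h_polynomial \<I>) j" if "j \<le> ?d" for j
    using that by (simp add: h_vector_def del: upt_Suc)
  ultimately show ?thesis by simp
qed

end

theory Submission
  imports Defs
begin

text \<open>
  Write \<open>n\<close> for the number of non-loops and \<open>m\<close> for the number of bases. In rank two the
  \<open>h\<close>-vector is \<open>(1, n - 2, m + 1 - n)\<close> (\<open>h_vector_rank_2\<close>).

  A triple \<open>(1, N, k)\<close> with \<open>k \<noteq> 0\<close> is the vector of a pure order ideal as soon as some \<open>k\<close>
  monomials of degree two in \<open>N\<close> variables involve every variable. The \<open>N - 1\<close> products of one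
  variable with each of the others already do so, hence every \<open>k \<ge> N - 1\<close> not exceeding the number
  \<open>N (N + 1) / 2\<close> of all such monomials is possible; for \<open>k = 0\<close> the ideal consists of \<open>1\<close> and the
  variables (\<open>pure_O_sequence_degree_2\<close>).

  The matroid meets these bounds. The bases are the edges of a graph on the non-loops, and
  being parallel is an equivalence relation, so the graph is complete multipartite: a parallel class
  of size \<open>a\<close> is joined completely to the \<open>b = n - a\<close> remaining non-loops and contains no edge.
  Thus \<open>m + 1 - n \<ge> (a - 1) (b - 1)\<close>, which is at least \<open>a + b - 3 = N - 1\<close> if \<open>a, b \<ge> 2\<close>.
  If \<open>b = 1\<close> the graph is a star and \<open>m + 1 - n = 0\<close>. If \<open>a = 1\<close> for all classes, the graph is
  complete and \<open>m + 1 - n\<close> attains the upper bound, since \<open>m\<close> is then as large as it can be for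
  \<open>n\<close> non-loops (\<open>bases_rank_2\<close>).
\<close>

section \<open>Pure order ideals generated in degree at most two\<close>

lemma pure_if_dominated:
  assumes "\<And>\<mu>. \<mu> \<in> \<O> \<Longrightarrow> \<exists>\<nu>\<in>\<O>. \<mu> \<subseteq># \<nu> \<and> size \<nu> = e"
  shows "pure \<O>"
  unfolding pure_def maximal_monomial_def using assms by metis

text \<open>The monomial with variables \<open>i \<le> j\<close> is encoded by the pair \<open>(j, i)\<close>, which makes the count
  a sum over \<open>j\<close>.\<close>

lemma card_degree_2_monomials:
  "card {{#i, j#} |i j. i < N \<and> j < N} = Suc N choose 2"
proof -
  let ?P = "SIGMA j:{..<N}. {..j}" and ?f = "\<lambda>(j, i). {#i, j#}"
  have "{{#i, j#} |i j. i < N \<and> j < N} = ?f ` ?P"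
  proof (intro equalityI subsetI)
    fix \<mu> assume "\<mu> \<in> {{#i, j#} |i j. i < N \<and> j < N}"
    then obtain i j where ij: "\<mu> = {#i, j#}" "i < N" "j < N" by blast
    then have "\<mu> = ?f (max i j, min i j)" "(max i j, min i j) \<in> ?P"
      by (auto simp: max_def min_def add_mset_commute)
    then show "\<mu> \<in> ?f ` ?P" by blast
  qed fastforce
  moreover have "inj_on ?f ?P"
    by (auto simp: inj_on_def add_eq_conv_ex add_mset_eq_single)
  moreover have "card ?P = Suc N choose 2"
    by (induction N) (simp_all add: numeral_2_eq_2)
  ultimately show ?thesis by (simp add: card_image)
qed

text \<open>The ideal consists of \<open>1\<close>, all \<open>N\<close> variables, and a set of \<open>k\<close> quadratic monomials which,
  unless empty, is chosen to contain the products of the variable \<open>0\<close> with all other variables.\<close>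

lemma pure_O_sequence_degree_2:
  assumes lower: "k = 0 \<or> N \<le> k + 1" and upper: "k \<le> Suc N choose 2"
  shows "pure_O_sequence [1, int N, int k]"
proof -
  let ?Q = "{{#i, j#} |i j. i < N \<and> j < N}"
  let ?star = "(\<lambda>i. {#0, i#}) ` {1..<N}"
  have finQ: "finite ?Q"
    by (rule finite_subset[of _ "(\<lambda>(i, j). {#i, j#}) ` ({..<N} \<times> {..<N})"]) auto
  have star: "?star \<subseteq> ?Q" by force
  have card_star: "card ?star = N - 1"
    by (subst card_image) (auto simp: inj_on_def)
  obtain S where S: "S \<subseteq> ?Q" "card S = k" "k \<noteq> 0 \<Longrightarrow> ?star \<subseteq> S"
  proof (cases "k = 0")
    case True
    then show ?thesis using that[of "{}"] by simp
  next
    case False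
    then have "card ?star \<le> k" "k \<le> card ?Q"
      using lower upper unfolding card_star card_degree_2_monomials by linarith+
    then show ?thesis
      using exists_subset_between[OF _ _ star finQ] that by blast
  qed
  have size_S: "size \<mu> = 2" if "\<mu> \<in> S" for \<mu> using S(1) that by auto
  let ?V = "(\<lambda>i. {#i#}) ` {..<N}"
  define \<O> where "\<O> = insert {#} (?V \<union> S)"
  have vars: "set_mset \<mu> \<subseteq> {..<N}" if "\<mu> \<in> \<O>" for \<mu>
  proof -
    have "set_mset \<mu> \<subseteq> {..<N}" if "\<mu> \<in> ?Q" using that by auto
    then show ?thesis using \<open>\<mu> \<in> \<O>\<close> S(1) by (auto simp: \<O>_def)
  qed
  have ideal: "order_ideal 2 \<O>"
    unfolding order_ideal_def
  proof (intro conjI ballI allI impI)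
    show "\<exists>V. finite V \<and> (\<forall>\<mu>\<in>\<O>. set_mset \<mu> \<subseteq> V)"
      using vars by (intro exI[of _ "{..<N}"]) simp
  next
    fix \<mu> \<nu> assume mu: "\<mu> \<in> \<O>" and sub: "\<nu> \<subseteq># \<mu>"
    show "\<nu> \<in> \<O>"
    proof (cases "\<nu> = \<mu>")
      case False
      then have lt: "size \<nu> < size \<mu>"
        using sub by (simp add: mset_subset_size subset_mset.less_le)
      have nu_vars: "set_mset \<nu> \<subseteq> {..<N}"
        using vars[OF mu] set_mset_mono[OF sub] by blast
      have "size \<mu> \<le> 2" using mu size_S by (auto simp: \<O>_def)
      with lt have "size \<nu> = 0 \<or> size \<nu> = 1" by linarith
      then have "\<nu> = {#} \<or> (\<exists>i. \<nu> = {#i#})"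
        using size_1_singleton_mset[of \<nu>] by auto
      then show ?thesis using nu_vars by (auto simp: \<O>_def)
    qed (use mu in simp)
  qed (use size_S in \<open>auto simp: \<O>_def\<close>)
  have pure: "pure \<O>"
  proof (cases "k = 0")
    case True
    then have "S = {}" using S(2) finite_subset[OF S(1) finQ] by simp
    then have O: "\<O> = insert {#} ?V" by (simp add: \<O>_def)
    \<comment> \<open>Without variables the only monomial is \<open>1\<close>, of degree zero.\<close>
    show ?thesis
      by (rule pure_if_dominated[where e = "if N = 0 then 0 else 1"]) (auto simp: O)
  next
    case False
    have covered: "\<exists>\<nu>\<in>S. {#i#} \<subseteq># \<nu>" if "i < N" for i
    proof (cases "N = 1")
      \<comment> \<open>With a single variable the star is empty and \<open>S\<close> consists of its square.\<close>
      case True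
      obtain \<nu> where "\<nu> \<in> S" using False S(2) by fastforce
      moreover from this have "\<nu> = {#i, i#}" using S(1) True that by auto
      ultimately show ?thesis by (intro bexI[of _ \<nu>]) simp_all
    next
      case N: False
      \<comment> \<open>The variable \<open>0\<close> lies in every product of the star, for instance in that with \<open>1\<close>.\<close>
      let ?j = "if i = 0 then 1 else i"
      have "{#0, ?j#} \<in> S" using S(3)[OF False] N that by auto
      moreover have "{#i#} \<subseteq># {#0, ?j#}" by auto
      ultimately show ?thesis by blast
    qed
    obtain \<sigma> where "\<sigma> \<in> S" using False S(2) by fastforce
    show ?thesis
    proof (rule pure_if_dominated[where e = 2])
      fix \<mu> assume "\<mu> \<in> \<O>"
      then consider "\<mu> = {#}" | i where "\<mu> = {#i#}" "i < N" | "\<mu> \<in> S"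
        by (auto simp: \<O>_def)
      then have "\<exists>\<nu>\<in>S. \<mu> \<subseteq># \<nu>"
        using covered \<open>\<sigma> \<in> S\<close> by cases auto
      then show "\<exists>\<nu>\<in>\<O>. \<mu> \<subseteq># \<nu> \<and> size \<nu> = 2"
        using size_S by (auto simp: \<O>_def)
    qed
  qed
  have "{\<mu> \<in> \<O>. size \<mu> = 0} = {{#}}" "{\<mu> \<in> \<O>. size \<mu> = 1} = ?V" "{\<mu> \<in> \<O>. size \<mu> = 2} = S"
    using size_S by (auto simp: \<O>_def)
  moreover have "card ?V = N" by (subst card_image) (auto simp: inj_on_def)
  ultimately have "F_vector 2 \<O> = [1, N, k]"
    by (simp add: F_vector_def numeral_2_eq_2 S(2))
  then show ?thesis
    unfolding pure_O_sequence_def using ideal pure by (intro exI[of _ 2] exI[of _ \<O>]) simp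
qed

section \<open>Bases of a matroid of rank two\<close>

text \<open>This is transitivity of parallelism: \<open>x\<close> cannot be parallel to both of two non-parallel
  elements \<open>y\<close> and \<open>z\<close>.\<close>

lemma (in matroid) indep_pair_augment:
  assumes "{x} \<in> \<I>" "{y, z} \<in> \<I>" "y \<noteq> z"
  shows "x \<noteq> y \<and> {x, y} \<in> \<I> \<or> x \<noteq> z \<and> {x, z} \<in> \<I>"
  using augmentation[OF assms(1,2)] assms(3) by (auto simp: insert_commute)

lemma h_vector_rank_2:
  assumes "matroid E \<I>" "matroid_rank \<I> = 2"
  shows "h_vector \<I> = [1, int (f_number \<I> 1) - 2, int (f_number \<I> 2) + 1 - int (f_number \<I> 1)]"
proof -
  interpret matroid E \<I> by fact
  have "finite A" if "A \<in> \<I>" for A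
    using that indep_subset_ground finite_ground finite_subset by blast
  then have "{A \<in> \<I>. card A = 0} = {{}}" using indep_empty by auto
  then have "f_number \<I> 0 = 1" by (simp add: f_number_def)
  then show ?thesis
    using assms(2)
    by (simp add: h_vector_def h_polynomial_def numeral_2_eq_2 upt_rec)
qed

text \<open>The upper bound says that the graph of bases has no multiple edges. The lower
  bounds compare, for a parallel class of size \<open>a\<close> with \<open>b\<close> non-loops outside, \<open>n = a + b\<close> with
  \<open>m \<ge> a b\<close>, unless all classes are singletons and the graph is complete. In the last disjunction the first case is \<open>h\<^sub>2 = 0\<close> and the second is \<open>h\<^sub>2 \<ge> h\<^sub>1 - 1\<close>.\<close>

lemma bases_rank_2:
  assumes "matroid E \<I>" "matroid_rank \<I> = 2"
  defines "n \<equiv> f_number \<I> 1" and "m \<equiv> f_number \<I> 2"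
  shows "2 \<le> n" "n \<le> m + 1" "m \<le> n choose 2" "m + 1 = n \<or> 2 * n \<le> m + 4"
proof -
  interpret matroid E \<I> by fact
  define X where "X = {x. {x} \<in> \<I>}"
  define G where "G = {A \<in> \<I>. card A = 2}"
  have finX: "finite X"
    by (rule finite_subset[OF _ finite_ground]) (use indep_subset_ground X_def in auto)
  have "{A \<in> \<I>. card A = 1} = (\<lambda>x. {x}) ` X"
    by (auto simp: X_def card_1_singleton_iff)
  then have n: "n = card X" by (simp add: n_def f_number_def card_image)
  have m: "m = card G" by (simp add: m_def G_def f_number_def)
  have edgeX: "x \<in> X" if "A \<in> G" "x \<in> A" for x A
    using that indep_subset[of A "{x}"] by (auto simp: G_def X_def)
  have G_sub: "G \<subseteq> {A. A \<subseteq> X \<and> card A = 2}" using edgeX by (auto simp: G_def)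
  have finG: "finite G"
    by (rule finite_subset[OF G_sub]) (use finX in auto)
  show "m \<le> n choose 2"
    using card_mono[OF _ G_sub] finX by (simp add: m n n_subsets)
  obtain e where "basis \<I> e" using basis_exists by blast
  then have "e \<in> G" using card_basis assms(2) by (auto simp: G_def basis_def)
  then obtain u v where uv: "u \<noteq> v" "{u, v} \<in> G"
    by (auto simp: G_def card_2_iff)
  then have uvX: "u \<in> X" "v \<in> X" using edgeX by auto
  show n2: "2 \<le> n"
    using card_mono[OF finX, of "{u, v}"] uv(1) uvX by (simp add: n)
  define cls where "cls p = {x \<in> X. x = p \<or> {p, x} \<notin> \<I>}" for p
  \<comment> \<open>Two non-loops in the class never form a basis, whereas one inside and one outside always do.
    The last equality holds because a single element outside leaves no other bases.\<close>
  have class_bounds: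
    "1 \<le> card (cls p)" "1 \<le> card (X - cls p)" "card (cls p) + card (X - cls p) = n"
    "card (cls p) * card (X - cls p) \<le> m"
    "card (X - cls p) = 1 \<Longrightarrow> m = card (cls p)"
    if p: "p \<in> X" for p
  proof -
    have sub: "cls p \<subseteq> X" by (auto simp: cls_def)
    then have fin: "finite (cls p)" using finX finite_subset by blast
    have "p \<in> cls p" using p by (simp add: cls_def)
    then show "1 \<le> card (cls p)" using fin by (auto simp: Suc_le_eq card_gt_0_iff)
    have no_edge: False if "{x, y} \<in> \<I>" "x \<noteq> y" "x \<in> cls p" "y \<in> cls p" for x y
      using indep_pair_augment[of p x y] that p by (auto simp: cls_def X_def)
    have "\<not> (u \<in> cls p \<and> v \<in> cls p)" using no_edge uv by (auto simp: G_def)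
    then have "X - cls p \<noteq> {}" using uvX by blast
    then show "1 \<le> card (X - cls p)" using finX by (simp add: Suc_le_eq card_gt_0_iff)
    show "card (cls p) + card (X - cls p) = n"
      using card_Diff_subset[OF fin sub] card_mono[OF finX sub] by (simp add: n)
    let ?f = "\<lambda>(x, y). {x, y}" and ?P = "cls p \<times> (X - cls p)"
    have inj: "inj_on ?f ?P" by (auto simp: inj_on_def doubleton_eq_iff)
    have join: "?f ` ?P \<subseteq> G"
    proof clarify
      fix x y assume xy: "x \<in> cls p" "y \<in> X" "y \<notin> cls p"
      then have "{p, y} \<in> \<I>" "p \<noteq> y" "x \<noteq> y" by (auto simp: cls_def)
      then have "{x, y} \<in> \<I>"
        using indep_pair_augment[of x p y] xy by (auto simp: cls_def X_def insert_commute)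
      with \<open>x \<noteq> y\<close> show "{x, y} \<in> G" by (simp add: G_def)
    qed
    show "card (cls p) * card (X - cls p) \<le> m"
      using card_mono[OF finG join] by (simp add: card_image[OF inj] m card_cartesian_product)
    show "m = card (cls p)" if single: "card (X - cls p) = 1"
    proof -
      from single obtain z where z: "X - cls p = {z}" by (auto simp: card_1_singleton_iff)
      have "G \<subseteq> ?f ` ?P"
      proof
        fix A assume A: "A \<in> G"
        then obtain x y where xy: "A = {x, y}" "x \<noteq> y" by (auto simp: G_def card_2_iff)
        have "{x, y} \<in> \<I>" using A xy by (simp add: G_def)
        moreover have "x \<in> X" "y \<in> X" using edgeX[OF A] xy by simp_all
        ultimately have "x \<in> cls p \<and> y = z \<or> y \<in> cls p \<and> x = z"
          using no_edge[of x y] z xy(2) by (metis DiffI singletonD)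
        then show "A \<in> ?f ` ?P" using xy z by (auto simp: insert_commute)
      qed
      then have "G = ?f ` ?P" using join by blast
      then show ?thesis using single by (simp add: card_image[OF inj] m card_cartesian_product)
    qed
  qed
  \<comment> \<open>For class size \<open>a\<close> and complement size \<open>b\<close>, the reason is \<open>(a - 1) (b - 1) \<ge> 0\<close>.\<close>
  show "n \<le> m + 1"
  proof -
    obtain a b where "card (cls u) = Suc a" "card (X - cls u) = Suc b"
      using class_bounds(1,2)[OF uvX(1)] by (metis Suc_le_D One_nat_def)
    then show ?thesis using class_bounds(3,4)[OF uvX(1)] by simp
  qed
  show "m + 1 = n \<or> 2 * n \<le> m + 4"
  proof (cases "\<exists>p\<in>X. 2 \<le> card (cls p)")
    case True
    then obtain p where p: "p \<in> X" "2 \<le> card (cls p)" by blast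
    show ?thesis
    proof (cases "card (X - cls p) = 1")
      case True
      then show ?thesis using class_bounds(3,5)[OF p(1)] by simp
    next
      case False
      \<comment> \<open>With both sizes at least two, now \<open>(a - 2) (b - 2) \<ge> 0\<close> is used.\<close>
      then have "2 \<le> card (X - cls p)" using class_bounds(2)[OF p(1)] by linarith
      then obtain a b where "card (cls p) = a + 2" "card (X - cls p) = b + 2"
        using p(2) by (metis le_Suc_ex add.commute)
      then show ?thesis using class_bounds(3,4)[OF p(1)] by simp
    qed
  next
    case False
    have "{A. A \<subseteq> X \<and> card A = 2} \<subseteq> G"
    proof clarify
      fix A assume A: "A \<subseteq> X" "card A = 2"
      then obtain x y where xy: "A = {x, y}" "x \<noteq> y" by (auto simp: card_2_iff)
      have "x \<in> X" "y \<in> X" using A xy by auto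
      have "card (cls x) = 1" using False class_bounds(1)[OF \<open>x \<in> X\<close>] \<open>x \<in> X\<close> by force
      moreover have "x \<in> cls x" using \<open>x \<in> X\<close> by (simp add: cls_def)
      ultimately have "y \<notin> cls x" using xy(2) by (auto simp: card_1_singleton_iff)
      then show "A \<in> G" using \<open>y \<in> X\<close> xy by (auto simp: cls_def G_def)
    qed
    then have "m = n choose 2"
      using G_sub n_subsets[OF finX, of 2] by (simp add: m n subset_antisym)
    moreover obtain r where r: "n = r + 2" using n2 by (metis le_Suc_ex add.commute)
    moreover have "(r + 2) choose 2 = Suc r + (Suc r choose 2)"
      by (simp add: numeral_2_eq_2)
    moreover have "r \<le> Suc r choose 2"
      by (induction r) (auto simp: numeral_2_eq_2)
    ultimately have "2 * r \<le> m" by simp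
    then show ?thesis using r by simp
  qed
qed

theorem theorem2p1:
  fixes E :: "'a set" and \<I> :: "'a set set"
  assumes "matroid E \<I>"
    and "matroid_rank \<I> = 2"
  shows "pure_O_sequence (h_vector \<I>)"
proof -
  define n m where "n = f_number \<I> 1" and "m = f_number \<I> 2"
  note bounds = bases_rank_2[OF assms, folded n_def m_def]
  obtain N where N: "n = N + 2" using bounds(1) by (metis le_Suc_ex add.commute)
  \<comment> \<open>\<open>n choose 2 = (n - 1) + (n - 1 choose 2)\<close>, so subtracting \<open>n - 1\<close> turns the bound on \<open>m\<close>
    into that on the last entry.\<close>
  have "m + 1 - n \<le> Suc N choose 2" using bounds(3) by (simp add: N numeral_2_eq_2)
  moreover have "m + 1 - n = 0 \<or> N \<le> (m + 1 - n) + 1" using bounds(4) N by linarith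
  ultimately have "pure_O_sequence [1, int N, int (m + 1 - n)]"
    by (intro pure_O_sequence_degree_2)
  moreover have "h_vector \<I> = [1, int N, int (m + 1 - n)]"
    using h_vector_rank_2[OF assms, folded n_def m_def] bounds(2) N by (simp add: of_nat_diff)
  ultimately show ?thesis by simp
qed

end
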